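(* For every rational number $p/q$ with $9/10 \le p/q < 1$, there exist infinitely many cyclically $4$-connected cubic graphs $G$ of girth $5$ such that $m_3(G) = p/q$.
   Context: For a bridgeless cubic graph $G$, $m_3(G)$ denotes the maximum, over all choices of three perfect matchings $M_1, M_2, M_3$ of $G$, of $|M_1\cup M_2\cup M_3|$, divided by $|E(G)|$. A graph is cyclically $k$-connected if no set of fewer than $k$ edges is cycle-separating, i.e. its removal never leaves two components each containing a cycle. *)

theory Defs
  imports Complex_Main "HOL-Library.Extended_Nat"
begin

text \<open>Finite simple graphs on vertex set V (vertices are naturals), edges are 2-element sets.
  Girth 5 forces simplicity, so simple graphs suffice.\<close>

definition simple_graph :: "nat set \<Rightarrow> nat set set \<Rightarrow> bool" where
  "simple_graph V E \<longleftrightarrow> finite V \<and>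
     (\<forall>e\<in>E. \<exists>u v. u \<noteq> v \<and> u \<in> V \<and> v \<in> V \<and> e = {u, v})"

definition degree :: "nat set set \<Rightarrow> nat \<Rightarrow> nat" where
  "degree E v = card {e \<in> E. v \<in> e}"

definition cubic_graph :: "nat set \<Rightarrow> nat set set \<Rightarrow> bool" where
  "cubic_graph V E \<longleftrightarrow> simple_graph V E \<and> (\<forall>v\<in>V. degree E v = 3)"

definition perfect_matching :: "nat set \<Rightarrow> nat set set \<Rightarrow> nat set set \<Rightarrow> bool" where
  "perfect_matching V E M \<longleftrightarrow> M \<subseteq> E \<and> (\<forall>v\<in>V. card {e \<in> M. v \<in> e} = 1)"

definition reach :: "nat set set \<Rightarrow> nat \<Rightarrow> nat \<Rightarrow> bool" where
  "reach E = (\<lambda>u v. {u, v} \<in> E)\<^sup>*\<^sup>*"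

definition bridgeless :: "nat set \<Rightarrow> nat set set \<Rightarrow> bool" where
  "bridgeless V E \<longleftrightarrow> (\<forall>u v. {u, v} \<in> E \<longrightarrow> reach (E - {{u, v}}) u v)"

definition is_cycle :: "nat set \<Rightarrow> nat set set \<Rightarrow> nat list \<Rightarrow> bool" where
  "is_cycle V E xs \<longleftrightarrow> length xs \<ge> 3 \<and> distinct xs \<and> set xs \<subseteq> V \<and>
     (\<forall>i < length xs. {xs ! i, xs ! ((i + 1) mod length xs)} \<in> E)"

definition girth :: "nat set \<Rightarrow> nat set set \<Rightarrow> enat" where
  "girth V E = (INF xs \<in> {xs. is_cycle V E xs}. enat (length xs))"

definition components :: "nat set \<Rightarrow> nat set set \<Rightarrow> nat set set" where
  "components V E = {{w \<in> V. reach E u w} | u. u \<in> V}"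

definition component_has_cycle :: "nat set \<Rightarrow> nat set set \<Rightarrow> nat set \<Rightarrow> bool" where
  "component_has_cycle V E C \<longleftrightarrow> (\<exists>xs. is_cycle V E xs \<and> set xs \<subseteq> C)"

definition cycle_separating :: "nat set \<Rightarrow> nat set set \<Rightarrow> nat set set \<Rightarrow> bool" where
  "cycle_separating V E F \<longleftrightarrow> F \<subseteq> E \<and>
     (\<exists>C1 C2. C1 \<in> components V (E - F) \<and> C2 \<in> components V (E - F) \<and> C1 \<noteq> C2 \<and>
        component_has_cycle V (E - F) C1 \<and> component_has_cycle V (E - F) C2)"

definition cyclically_connected :: "nat \<Rightarrow> nat set \<Rightarrow> nat set set \<Rightarrow> bool" where
  "cyclically_connected k V E \<longleftrightarrow>
     (\<forall>F. F \<subseteq> E \<and> card F < k \<longrightarrow> \<not> cycle_separating V E F)"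

definition m3 :: "nat set \<Rightarrow> nat set set \<Rightarrow> real" where
  "m3 V E = real (Max {card (M1 \<union> M2 \<union> M3) | M1 M2 M3.
      perfect_matching V E M1 \<and> perfect_matching V E M2 \<and> perfect_matching V E M3})
    / real (card E)"

definition graph_iso :: "nat set \<times> nat set set \<Rightarrow> nat set \<times> nat set set \<Rightarrow> bool" where
  "graph_iso G H \<longleftrightarrow> (\<exists>f. bij_betw f (fst G) (fst H) \<and>
     (\<forall>u\<in>fst G. \<forall>v\<in>fst G. {u, v} \<in> snd G \<longleftrightarrow> {f u, f v} \<in> snd H))"

end

theory Submission
  imports Defs "HOL-Library.Nat_Bijection"
begin

text \<open>
  The graphs are rings of blocks of two kinds, consecutive blocks being joined by two edges.
  An I-block is the Petersen graph minus two adjacent vertices; an H-block is the Petersen graph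
  with two edges at maximal distance cut in half. In a 3-edge-colouring the two edges leaving an
  I-block on either side have equal colours, whereas those leaving an H-block on either side have
  different colours, so an H-block between two I-blocks is a local obstruction. Quantitatively, such
  an H-block always costs three edges not covered by three given perfect matchings: a potential on the
  possible states of the two edges between consecutive blocks lets an I-block share its own uncovered
  edges with its two neighbours, and both local inequalities are finite checks. Three explicit
  matchings attain this bound. With \<^term>\<open>4 * r * k\<close> H-blocks among \<^term>\<open>p * k\<close> blocks, where
  \<^term>\<open>r = q - p\<close>, there are \<^term>\<open>12 * q * k\<close> edges, exactly \<^term>\<open>12 * r * k\<close> of them uncovered; the
  H-blocks can be kept apart because \<^term>\<open>8 * r \<le> p\<close>.

  A block meeting both sides of an edge cut contributes at least two edges to it, and so do two
  consecutive blocks on different sides. A cut of at most three edges therefore separates vertices of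
  a single block and can be examined there.
\<close>

section \<open>Edge cuts and cyclic connectivity\<close>

definition edge_cut :: "'a set set \<Rightarrow> 'a set \<Rightarrow> 'a set set" where
  "edge_cut E S = {e \<in> E. e \<inter> S \<noteq> {} \<and> \<not> e \<subseteq> S}"

definition component :: "nat set \<Rightarrow> nat set set \<Rightarrow> nat \<Rightarrow> nat set" where
  "component V E u = {w \<in> V. reach E u w}"

lemma reach_sym: "reach E u v \<Longrightarrow> reach E v u"
  unfolding reach_def by (rule sympD[OF symp_rtranclp]) (auto simp: symp_def insert_commute)

lemma reach_trans: "reach E u v \<Longrightarrow> reach E v w \<Longrightarrow> reach E u w"
  unfolding reach_def by (rule rtranclp_trans)

lemma reach_edge: "{u, v} \<in> E \<Longrightarrow> reach E u v"
  unfolding reach_def by (rule r_into_rtranclp)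

lemma component_eq_if_meet:
  assumes "component V E u \<inter> component V E v \<noteq> {}"
  shows "component V E u = component V E v"
proof -
  obtain w where "reach E u w" "reach E v w"
    using assms by (auto simp: component_def)
  then have uv: "reach E u v"
    by (rule reach_trans[OF _ reach_sym])
  then have vu: "reach E v u"
    by (rule reach_sym)
  show ?thesis
    using reach_trans[OF uv] reach_trans[OF vu] by (auto simp: component_def)
qed

lemma simple_graph_edge_subset: "simple_graph V E \<Longrightarrow> e \<in> E \<Longrightarrow> e \<subseteq> V"
  by (auto simp: simple_graph_def)

lemma simple_graph_finite_edges: "simple_graph V E \<Longrightarrow> finite E"
  by (rule finite_subset[of E "Pow V"]) (auto simp: simple_graph_def)

lemma edge_cut_component_subset:
  assumes "simple_graph V E"
  shows "edge_cut E (component V (E - F) u) \<subseteq> F"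
proof
  fix e assume cut: "e \<in> edge_cut E (component V (E - F) u)"
  then obtain a b where ab: "e = {a, b}" "a \<in> V" "b \<in> V"
    using assms unfolding edge_cut_def simple_graph_def by blast
  show "e \<in> F"
  proof (rule ccontr)
    assume "e \<notin> F"
    then have "reach (E - F) a b"
      using cut ab(1) by (intro reach_edge) (simp add: edge_cut_def)
    then have "reach (E - F) u a \<longleftrightarrow> reach (E - F) u b"
      by (blast intro: reach_trans reach_sym)
    then show False
      using cut ab by (auto simp: edge_cut_def component_def)
  qed
qed

lemma edge_cut_Compl: "simple_graph V E \<Longrightarrow> edge_cut E (V - S) = edge_cut E S"
  using simple_graph_edge_subset[of V E] unfolding edge_cut_def by blast

lemma bridgelessI:
  assumes "simple_graph V E"
    and cuts: "\<And>S. S \<subseteq> V \<Longrightarrow> S \<noteq> {} \<Longrightarrow> S \<noteq> V \<Longrightarrow> 2 \<le> card (edge_cut E S)"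
  shows "bridgeless V E"
  unfolding bridgeless_def
proof (intro allI impI)
  fix u v assume uv: "{u, v} \<in> E"
  let ?S = "component V (E - {{u, v}}) u"
  have "u \<in> ?S" "v \<in> V"
    using simple_graph_edge_subset[OF assms(1) uv] by (auto simp: component_def reach_def)
  moreover have "card (edge_cut E ?S) \<le> 1"
    using card_mono[OF _ edge_cut_component_subset[OF assms(1), of "{{u, v}}" u]] by simp
  ultimately have "?S = V"
    using cuts[of ?S] by (auto simp: component_def)
  then show "reach (E - {{u, v}}) u v"
    using \<open>v \<in> V\<close> unfolding component_def by blast
qed

lemma three_le_card_if_cycle:
  assumes "is_cycle V E xs" "set xs \<subseteq> S" "finite S"
  shows "3 \<le> card S"
  using assms card_mono[of S "set xs"] by (simp add: is_cycle_def distinct_card)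

lemma cyclically_connectedI:
  assumes "simple_graph V E"
    and cuts: "\<And>S. S \<subseteq> V \<Longrightarrow> 3 \<le> card S \<Longrightarrow> 3 \<le> card (V - S) \<Longrightarrow> k \<le> card (edge_cut E S)"
  shows "cyclically_connected k V E"
  unfolding cyclically_connected_def
proof (intro allI impI notI)
  fix F assume F: "F \<subseteq> E \<and> card F < k" and "cycle_separating V E F"
  then obtain u v xs ys where "component V (E - F) u \<noteq> component V (E - F) v"
    and xs: "is_cycle V (E - F) xs" "set xs \<subseteq> component V (E - F) u"
    and ys: "is_cycle V (E - F) ys" "set ys \<subseteq> component V (E - F) v"
    unfolding cycle_separating_def components_def component_has_cycle_def component_def by blast
  then have "component V (E - F) u \<inter> component V (E - F) v = {}"
    using component_eq_if_meet by blast
  then have "set ys \<subseteq> V - component V (E - F) u"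
    using ys by (auto simp: component_def)
  moreover have "finite V" "finite F"
    using assms(1) F simple_graph_finite_edges[of V E] by (auto simp: simple_graph_def finite_subset)
  moreover have sub: "component V (E - F) u \<subseteq> V"
    by (auto simp: component_def)
  ultimately have "k \<le> card (edge_cut E (component V (E - F) u))"
    using three_le_card_if_cycle xs ys by (intro cuts) (meson finite_Diff finite_subset)+
  also have "\<dots> \<le> card F"
    using \<open>finite F\<close> by (rule card_mono) (rule edge_cut_component_subset[OF assms(1)])
  finally show False
    using F by simp
qed

section \<open>Girth at least five\<close>

definition triangle_free :: "'a set set \<Rightarrow> bool" where
  "triangle_free E \<longleftrightarrow> (\<forall>x y z. {x, y} \<in> E \<longrightarrow> {y, z} \<in> E \<longrightarrow> {z, x} \<notin> E)"

definition quadrilateral_free :: "'a set set \<Rightarrow> bool" where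
  "quadrilateral_free E \<longleftrightarrow>
    (\<forall>w x y z. {w, x} \<in> E \<longrightarrow> {x, y} \<in> E \<longrightarrow> {y, z} \<in> E \<longrightarrow> y \<noteq> w \<longrightarrow> z \<noteq> x \<longrightarrow> {z, w} \<notin> E)"

lemma is_cycle_edge:
  assumes "is_cycle V E xs" "i < length xs"
  shows "{xs ! i, xs ! (Suc i mod length xs)} \<in> E"
  using assms by (simp add: is_cycle_def)

lemma five_le_girthI:
  assumes "triangle_free E" "quadrilateral_free E"
  shows "5 \<le> girth V E"
proof -
  have "5 \<le> length xs" if cycle: "is_cycle V E xs" for xs
  proof (rule ccontr)
    assume "\<not> 5 \<le> length xs"
    then consider "length xs = 3" | "length xs = 4"
      using cycle unfolding is_cycle_def by linarith
    then show False
    proof cases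
      case 1
      then obtain x y z where xs: "xs = [x, y, z]"
        by (auto simp: length_Suc_conv numeral_eq_Suc)
      have "{x, y} \<in> E" "{y, z} \<in> E" "{z, x} \<in> E"
        using is_cycle_edge[OF cycle, of 0] is_cycle_edge[OF cycle, of 1] is_cycle_edge[OF cycle, of 2]
        by (simp_all add: xs)
      then show False
        using assms(1) unfolding triangle_free_def by blast
    next
      case 2
      then obtain w x y z where xs: "xs = [w, x, y, z]"
        by (auto simp: length_Suc_conv numeral_eq_Suc)
      have "{w, x} \<in> E" "{x, y} \<in> E" "{y, z} \<in> E" "{z, w} \<in> E"
        using is_cycle_edge[OF cycle, of 0] is_cycle_edge[OF cycle, of 1]
          is_cycle_edge[OF cycle, of 2] is_cycle_edge[OF cycle, of 3]
        by (simp_all add: xs)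
      moreover have "y \<noteq> w" "z \<noteq> x"
        using cycle by (auto simp: is_cycle_def xs)
      ultimately show False
        using assms(2) unfolding quadrilateral_free_def by blast
    qed
  qed
  then show ?thesis
    unfolding girth_def by (intro INF_greatest) (simp add: numeral_eq_enat)
qed

lemma girth_le_length: "is_cycle V E xs \<Longrightarrow> girth V E \<le> enat (length xs)"
  unfolding girth_def by (rule INF_lower) simp

section \<open>Uncovered edges\<close>

lemma m3_eqI:
  assumes "finite E" "E \<noteq> {}"
    and lower: "\<And>L M N. perfect_matching V E L \<Longrightarrow> perfect_matching V E M \<Longrightarrow> perfect_matching V E N \<Longrightarrow>
      c \<le> card (E - (L \<union> M \<union> N))"
    and opt: "perfect_matching V E L" "perfect_matching V E M" "perfect_matching V E N"
      "card (E - (L \<union> M \<union> N)) = c"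
  shows "m3 V E = 1 - real c / real (card E)"
proof -
  let ?A = "{card (L \<union> M \<union> N) | L M N.
    perfect_matching V E L \<and> perfect_matching V E M \<and> perfect_matching V E N}"
  have covered: "card (L \<union> M \<union> N) + card (E - (L \<union> M \<union> N)) = card E"
    if "perfect_matching V E L" "perfect_matching V E M" "perfect_matching V E N" for L M N
  proof -
    have "L \<union> M \<union> N \<subseteq> E"
      using that by (auto simp: perfect_matching_def)
    then show ?thesis
      using assms(1) by (metis card_Diff_subset card_mono finite_subset le_add_diff_inverse)
  qed
  have upper: "x \<le> card E - c" if "x \<in> ?A" for x
  proof -
    from that obtain L' M' N' where x: "x = card (L' \<union> M' \<union> N')"
      and pm: "perfect_matching V E L'" "perfect_matching V E M'" "perfect_matching V E N'"
      by blast
    show ?thesis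
      using covered[OF pm] lower[OF pm] unfolding x by linarith
  qed
  have "card E - c \<in> ?A"
    using opt covered[OF opt(1-3)] by (intro CollectI exI[of _ L] exI[of _ M] exI[of _ N]) simp
  moreover have "finite ?A"
    using upper by (meson finite_nat_set_iff_bounded_le)
  ultimately have "Max ?A = card E - c"
    using upper by (intro Max_eqI)
  moreover have "c \<le> card E" "card E \<noteq> 0"
    using opt(4) assms(1,2) by (auto intro: card_mono)
  ultimately show ?thesis
    unfolding m3_def by (simp only: of_nat_diff diff_divide_distrib) simp
qed

section \<open>Exact transversals\<close>

definition residual :: "'a \<Rightarrow> 'a list list \<Rightarrow> 'a list list \<Rightarrow> 'a list list" where
  "residual x us ts =
    map (filter (\<lambda>y. \<forall>s\<in>set us. x \<in> set s \<longrightarrow> y \<notin> set s)) (filter (\<lambda>s. x \<notin> set s) ts)"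

function (sequential) exact_transversals :: "'a list list \<Rightarrow> 'a list list" where
  "exact_transversals [] = [[]]"
| "exact_transversals (t # ts) =
    concat (map (\<lambda>x. map ((#) x) (exact_transversals (residual x (t # ts) ts))) t)"
  by pat_completeness auto
termination
  by (relation "measure length") (simp_all add: residual_def less_Suc_eq_le)

lemma residual_transversal:
  assumes exact: "\<forall>s\<in>set us. card (M \<inter> set s) = 1" and "set ts \<subseteq> set us" "x \<in> M"
  shows "\<forall>s\<in>set (residual x us ts). card (M \<inter> set s) = 1"
    and "M \<inter> \<Union> (set ` set (residual x us ts)) = M \<inter> \<Union> (set ` set ts) - {x}"
proof -
  define allowed where "allowed y \<longleftrightarrow> (\<forall>s\<in>set us. x \<in> set s \<longrightarrow> y \<notin> set s)" for y
  have residual: "residual x us ts = map (filter allowed) (filter (\<lambda>s. x \<notin> set s) ts)"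
    by (simp add: residual_def allowed_def[abs_def])
  have eq_x: "y = x" if "s \<in> set us" "x \<in> set s" "y \<in> M" "y \<in> set s" for s y
  proof -
    obtain z where "M \<inter> set s = {z}"
      using exact \<open>s \<in> set us\<close> by (meson card_1_singletonE)
    moreover have "{x, y} \<subseteq> M \<inter> set s"
      using that(2-4) \<open>x \<in> M\<close> by blast
    ultimately show ?thesis
      by simp
  qed
  then have unchanged: "M \<inter> set (filter allowed s) = M \<inter> set s" if "x \<notin> set s" for s
    using that by (auto simp: allowed_def)
  show "\<forall>s\<in>set (residual x us ts). card (M \<inter> set s) = 1"
    using exact \<open>set ts \<subseteq> set us\<close> unchanged by (auto simp: residual)
  have "M \<inter> \<Union> (set ` set (residual x us ts)) = (\<Union>s\<in>{s \<in> set ts. x \<notin> set s}. M \<inter> set (filter allowed s))"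
    by (auto simp: residual)
  also have "\<dots> = (\<Union>s\<in>{s \<in> set ts. x \<notin> set s}. M \<inter> set s)"
    using unchanged by (intro SUP_cong refl) blast
  also have "\<dots> = M \<inter> \<Union> (set ` set ts) - {x}"
    using eq_x \<open>set ts \<subseteq> set us\<close> by auto
  finally show "M \<inter> \<Union> (set ` set (residual x us ts)) = M \<inter> \<Union> (set ` set ts) - {x}" .
qed

lemma exact_transversals_complete:
  assumes "\<forall>t\<in>set ts. card (M \<inter> set t) = 1"
  shows "\<exists>xs\<in>set (exact_transversals ts). set xs = M \<inter> \<Union> (set ` set ts)"
  using assms
proof (induction ts rule: exact_transversals.induct)
  case 1
  then show ?case by simp
next
  case (2 t ts)
  have "card (M \<inter> set t) = 1"
    using 2(2) by simp
  then obtain x where x: "M \<inter> set t = {x}"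
    by (rule card_1_singletonE)
  then have "x \<in> M" "x \<in> set t"
    by blast+
  have "set ts \<subseteq> set (t # ts)"
    by auto
  note residual = residual_transversal[OF 2(2) this \<open>x \<in> M\<close>]
  obtain xs where xs: "xs \<in> set (exact_transversals (residual x (t # ts) ts))"
      "set xs = M \<inter> \<Union> (set ` set ts) - {x}"
    using 2(1)[OF \<open>x \<in> set t\<close> residual(1)] unfolding residual(2) by blast
  have "x # xs \<in> set (exact_transversals (t # ts))"
    using \<open>x \<in> set t\<close> xs(1) by auto
  moreover have "set (x # xs) = M \<inter> \<Union> (set ` set (t # ts))"
    using x xs(2) by auto
  ultimately show ?case by blast
qed

section \<open>Dipoles\<close>

text \<open>
  A dipole is a block with vertices \<open>0, \<dots>, order - 1\<close> that is to be joined to its two neighbours in a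
  ring: its vertices 2 and 3 are joined to the vertices 0 and 1 of the following block. Seen from a
  block, \<open>Prev c\<close> and \<open>Next c\<close> are the vertices \<open>c\<close> of the neighbours. \<open>own_edges\<close> omits the edges to
  the preceding block, so that every edge of a ring is an own edge of exactly one block.
\<close>

datatype dipole = Dipole (order: nat) (inner: "(nat \<times> nat) list")

datatype site = Prev nat | Here nat | Next nat

definition inner_edges :: "dipole \<Rightarrow> (site \<times> site) list" where
  "inner_edges D = map (map_prod Here Here) (inner D)"

definition own_edges :: "dipole \<Rightarrow> (site \<times> site) list" where
  "own_edges D = (Here 2, Next 0) # (Here 3, Next 1) # inner_edges D"

definition all_edges :: "dipole \<Rightarrow> (site \<times> site) list" where
  "all_edges D = (Prev 2, Here 0) # (Prev 3, Here 1) # own_edges D"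

definition star :: "dipole \<Rightarrow> nat \<Rightarrow> (site \<times> site) list" where
  "star D c = filter (\<lambda>k. fst k = Here c \<or> snd k = Here c) (all_edges D)"

definition cubic_dipole :: "dipole \<Rightarrow> bool" where
  "cubic_dipole D \<longleftrightarrow> 4 \<le> order D \<and> distinct (inner D) \<and>
    (\<forall>(a, b)\<in>set (inner D). a < b \<and> b < order D) \<and> (\<forall>c<order D. length (star D c) = 3)"

lemma own_edges_cases:
  assumes "k \<in> set (own_edges D)"
  obtains "k = (Here 2, Next 0)" | "k = (Here 3, Next 1)"
    | a b where "k = (Here a, Here b)" "(a, b) \<in> set (inner D)"
  using assms by (auto simp: own_edges_def inner_edges_def)

lemma all_edges_cases:
  assumes "k \<in> set (all_edges D)"
  obtains "k = (Prev 2, Here 0)" | "k = (Prev 3, Here 1)" | "k \<in> set (own_edges D)"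
  using assms by (auto simp: all_edges_def)

lemma own_in_all_edges [simp]: "k \<in> set (own_edges D) \<Longrightarrow> k \<in> set (all_edges D)"
  by (simp add: all_edges_def)

lemma in_star_iff: "k \<in> set (star D c) \<longleftrightarrow> k \<in> set (all_edges D) \<and> (fst k = Here c \<or> snd k = Here c)"
  by (simp add: star_def)

lemma link_in_own_edges [simp]:
  "(Here 2, Next 0) \<in> set (own_edges D)" "(Here 3, Next 1) \<in> set (own_edges D)"
  "(Here 3, Next (Suc 0)) \<in> set (own_edges D)"
  by (simp_all add: own_edges_def)

lemma distinct_all_edges:
  assumes "cubic_dipole D"
  shows "distinct (all_edges D)"
proof -
  have "inj_on (map_prod Here Here) A" for A
    by (auto simp: inj_on_def)
  then have "distinct (inner_edges D)"
    using assms by (simp add: cubic_dipole_def inner_edges_def distinct_map)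
  then show ?thesis
    by (auto simp: all_edges_def own_edges_def inner_edges_def)
qed

lemma distinct_star: "cubic_dipole D \<Longrightarrow> distinct (star D c)"
  by (simp add: star_def distinct_all_edges)

definition local_matching :: "dipole \<Rightarrow> (site \<times> site) set \<Rightarrow> bool" where
  "local_matching D M \<longleftrightarrow> (\<forall>c<order D. card (M \<inter> set (star D c)) = 1)"

lemma local_matching_cong:
  assumes "\<And>k. k \<in> set (all_edges D) \<Longrightarrow> k \<in> M \<longleftrightarrow> k \<in> N"
  shows "local_matching D M \<longleftrightarrow> local_matching D N"
proof -
  have "M \<inter> set (star D c) = N \<inter> set (star D c)" for c
    using assms by (auto simp: in_star_iff)
  then show ?thesis
    by (simp add: local_matching_def)
qed

section \<open>Rings of dipoles\<close>

definition vx :: "nat \<Rightarrow> nat \<Rightarrow> nat" where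
  "vx i c = prod_encode (i, c)"

lemma vx_eq_iff [simp]: "vx i c = vx j d \<longleftrightarrow> i = j \<and> c = d"
  by (simp add: vx_def prod_encode_eq)

lemma inj_on_vx: "inj_on (vx i) A"
  by (simp add: inj_on_def)

locale dipole_ring =
  fixes n :: nat and B :: "nat \<Rightarrow> dipole"
  assumes three_le_n: "3 \<le> n"
    and cubic_dipole: "\<And>i. cubic_dipole (B i)"
begin

definition nx :: "nat \<Rightarrow> nat" where
  "nx i = Suc i mod n"

definition pv :: "nat \<Rightarrow> nat" where
  "pv i = (i + (n - 1)) mod n"

lemma nx_less [simp]: "nx i < n" and pv_less [simp]: "pv i < n"
  using three_le_n by (simp_all add: nx_def pv_def)

lemma nx_pv [simp]: "i < n \<Longrightarrow> nx (pv i) = i"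
  using three_le_n by (simp add: nx_def pv_def mod_Suc_eq)

lemma pv_nx [simp]: "i < n \<Longrightarrow> pv (nx i) = i"
  unfolding nx_def pv_def mod_add_left_eq using three_le_n by simp

lemma nx_neq [simp]:
  "i < n \<Longrightarrow> nx i \<noteq> i" "i < n \<Longrightarrow> i \<noteq> nx i"
  "i < n \<Longrightarrow> nx (nx i) \<noteq> i" "i < n \<Longrightarrow> i \<noteq> nx (nx i)"
  using three_le_n by (auto simp: nx_def mod_Suc)

lemma pv_neq [simp]: "i < n \<Longrightarrow> pv i \<noteq> i" "i < n \<Longrightarrow> i \<noteq> pv i"
  using nx_neq(1)[of "pv i"] by auto

lemma nx_inj [simp]: "i < n \<Longrightarrow> j < n \<Longrightarrow> nx i = nx j \<longleftrightarrow> i = j"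
  by (metis pv_nx)

lemma sum_pv: "(\<Sum>i<n. f (pv i)) = (\<Sum>i<n. f i)"
  by (rule sum.reindex_bij_witness[of _ nx pv]) auto

lemma ring_induct [consumes 2, case_names start step]:
  assumes "m < n" "i < n" "P m" and step: "\<And>j. j < n \<Longrightarrow> P j \<Longrightarrow> P (nx j)"
  shows "P i"
proof -
  have "P ((m + k) mod n)" for k
  proof (induction k)
    case (Suc k)
    then show ?case
      using step[of "(m + k) mod n"] assms(1) by (simp add: nx_def mod_Suc_eq)
  qed (use assms in simp)
  from this[of "n - m + i"] show ?thesis
    using assms(1,2) by simp
qed

fun place :: "nat \<Rightarrow> site \<Rightarrow> nat" where
  "place i (Prev c) = vx (pv i) c"
| "place i (Here c) = vx i c"
| "place i (Next c) = vx (nx i) c"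

definition edge :: "nat \<Rightarrow> site \<times> site \<Rightarrow> nat set" where
  "edge i k = {place i (fst k), place i (snd k)}"

definition block :: "nat \<Rightarrow> nat set" where
  "block i = vx i ` {..<order (B i)}"

definition V :: "nat set" where
  "V = (\<Union>i<n. block i)"

definition E :: "nat set set" where
  "E = (\<Union>i<n. edge i ` set (own_edges (B i)))"

lemma vx_in_block_iff [simp]: "vx i c \<in> block j \<longleftrightarrow> i = j \<and> c < order (B i)"
  by (auto simp: block_def)

lemma vx_in_V_iff [simp]: "vx i c \<in> V \<longleftrightarrow> i < n \<and> c < order (B i)"
  by (auto simp: V_def block_def)

lemma V_cases:
  assumes "v \<in> V"
  obtains i c where "v = vx i c" "i < n" "c < order (B i)"
  using assms by (auto simp: V_def block_def)

lemma terminals_less_order [simp]: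
  "0 < order (B i)" "Suc 0 < order (B i)" "2 < order (B i)" "3 < order (B i)"
  using cubic_dipole[of i] by (simp_all add: cubic_dipole_def)

lemma inner_less: "(a, b) \<in> set (inner (B i)) \<Longrightarrow> a < b \<and> b < order (B i)"
  using cubic_dipole[of i] by (auto simp: cubic_dipole_def)

lemma edge_in_link [simp]:
  "i < n \<Longrightarrow> edge i (Prev 2, Here 0) = edge (pv i) (Here 2, Next 0)"
  "i < n \<Longrightarrow> edge i (Prev 3, Here 1) = edge (pv i) (Here 3, Next 1)"
  "i < n \<Longrightarrow> edge i (Prev 3, Here (Suc 0)) = edge (pv i) (Here 3, Next 1)"
  by (simp_all add: edge_def)

lemma edge_eq_iff:
  assumes "i < n" "k \<in> set (own_edges (B i))" "j < n" "l \<in> set (own_edges (B j))"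
  shows "edge i k = edge j l \<longleftrightarrow> i = j \<and> k = l"
  by (rule own_edges_cases[OF assms(2)]; rule own_edges_cases[OF assms(4)])
    (use assms(1,3) in \<open>auto simp: edge_def doubleton_eq_iff dest!: inner_less\<close>)

lemma simple_graph: "simple_graph V E"
proof -
  have "\<exists>u v. u \<noteq> v \<and> u \<in> V \<and> v \<in> V \<and> edge i k = {u, v}" if "i < n" "k \<in> set (own_edges (B i))" for i k
  proof (intro exI conjI)
    show "edge i k = {place i (fst k), place i (snd k)}"
      by (simp add: edge_def)
    show "place i (fst k) \<noteq> place i (snd k)" "place i (fst k) \<in> V" "place i (snd k) \<in> V"
      using that by (auto elim!: own_edges_cases dest: inner_less nx_neq(1))
  qed
  then show ?thesis
    by (auto simp: simple_graph_def E_def V_def block_def)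
qed

lemma card_filter_E:
  "card {e \<in> E. Q e} = (\<Sum>i<n. length (filter (\<lambda>k. Q (edge i k)) (own_edges (B i))))"
proof -
  let ?A = "SIGMA i:{..<n}. set (filter (\<lambda>k. Q (edge i k)) (own_edges (B i)))"
  have "{e \<in> E. Q e} = (\<lambda>(i, k). edge i k) ` ?A"
    by (auto simp: E_def)
  moreover have "inj_on (\<lambda>(i, k). edge i k) ?A"
    by (auto simp: inj_on_def edge_eq_iff)
  ultimately have "card {e \<in> E. Q e} = card ?A"
    by (simp add: card_image)
  also have "\<dots> = (\<Sum>i<n. card (set (filter (\<lambda>k. Q (edge i k)) (own_edges (B i)))))"
    by simp
  also have "\<dots> = (\<Sum>i<n. length (filter (\<lambda>k. Q (edge i k)) (own_edges (B i))))"
    using distinct_all_edges[OF cubic_dipole]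
    by (intro sum.cong refl distinct_card distinct_filter) (simp add: all_edges_def)
  finally show ?thesis .
qed

lemma own_edge_in_E: "i < n \<Longrightarrow> k \<in> set (own_edges (B i)) \<Longrightarrow> edge i k \<in> E"
  by (auto simp: E_def)

lemma edge_in_E:
  assumes "i < n" "k \<in> set (all_edges (B i))"
  shows "edge i k \<in> E"
  using assms(2)
  by (cases rule: all_edges_cases) (use assms(1) in \<open>simp_all add: own_edge_in_E\<close>)

lemma inj_on_edge:
  assumes "i < n"
  shows "inj_on (edge i) (set (all_edges (B i)))"
proof (rule inj_onI)
  fix k l assume "k \<in> set (all_edges (B i))" "l \<in> set (all_edges (B i))" "edge i k = edge i l"
  then show "k = l"
    using assms by (auto elim!: all_edges_cases simp: edge_eq_iff)
qed

lemma incident_edges: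
  assumes "i < n"
  shows "{e \<in> E. vx i c \<in> e} = edge i ` set (star (B i) c)"
proof (intro equalityI subsetI)
  fix e assume "e \<in> {e \<in> E. vx i c \<in> e}"
  then obtain j k where jk: "e = edge j k" "j < n" "k \<in> set (own_edges (B j))" "vx i c \<in> edge j k"
    by (auto simp: E_def)
  from jk(3) consider (here) "i = j" "k \<in> set (star (B i) c)"
    | (left) "i = nx j" "k = (Here 2, Next 0)" "c = 0"
    | (right) "i = nx j" "k = (Here 3, Next 1)" "c = 1"
    by (cases rule: own_edges_cases)
      (use jk(3,4) in \<open>auto simp: edge_def in_star_iff\<close>)
  then show "e \<in> edge i ` set (star (B i) c)"
  proof cases
    case left
    then show ?thesis
      using jk(1,2) by (intro image_eqI[of _ _ "(Prev 2, Here 0)"])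
        (simp_all add: in_star_iff all_edges_def)
  next
    case right
    then show ?thesis
      using jk(1,2) by (intro image_eqI[of _ _ "(Prev 3, Here 1)"])
        (simp_all add: in_star_iff all_edges_def)
  qed (simp add: jk)
next
  fix e assume "e \<in> edge i ` set (star (B i) c)"
  then show "e \<in> {e \<in> E. vx i c \<in> e}"
    using edge_in_E[OF assms] by (auto simp: in_star_iff edge_def)
qed

definition trace :: "nat \<Rightarrow> nat set set \<Rightarrow> (site \<times> site) set" where
  "trace i M = {k. edge i k \<in> M}"

lemma card_incident:
  assumes "i < n" "M \<subseteq> E"
  shows "card {e \<in> M. vx i c \<in> e} = card (trace i M \<inter> set (star (B i) c))"
proof -
  have "{e \<in> M. vx i c \<in> e} = {e \<in> E. vx i c \<in> e} \<inter> M"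
    using assms(2) by blast
  also have "\<dots> = edge i ` (trace i M \<inter> set (star (B i) c))"
    unfolding incident_edges[OF assms(1)] by (auto simp: trace_def)
  finally have "{e \<in> M. vx i c \<in> e} = edge i ` (trace i M \<inter> set (star (B i) c))" .
  moreover have "inj_on (edge i) (trace i M \<inter> set (star (B i) c))"
    using inj_on_edge[OF assms(1)] by (rule inj_on_subset) (auto simp: in_star_iff)
  ultimately show ?thesis
    by (simp add: card_image)
qed

lemma cubic_graph: "cubic_graph V E"
proof -
  have "degree E (vx i c) = 3" if "i < n" "c < order (B i)" for i c
  proof -
    have "trace i E \<inter> set (star (B i) c) = set (star (B i) c)"
      using edge_in_E[OF that(1)] by (auto simp: trace_def in_star_iff)
    then have "degree E (vx i c) = card (set (star (B i) c))"
      unfolding degree_def by (simp add: card_incident that(1))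
    also have "\<dots> = length (star (B i) c)"
      by (rule distinct_card[OF distinct_star[OF cubic_dipole]])
    finally show ?thesis
      using cubic_dipole[of i] that(2) by (simp add: cubic_dipole_def)
  qed
  then show ?thesis
    using simple_graph by (auto simp: cubic_graph_def elim: V_cases)
qed

lemma perfect_matching_iff:
  assumes "M \<subseteq> E"
  shows "perfect_matching V E M \<longleftrightarrow> (\<forall>i<n. local_matching (B i) (trace i M))"
  using assms unfolding perfect_matching_def local_matching_def
  by (auto simp flip: card_incident elim!: V_cases)

definition glue :: "(nat \<Rightarrow> (site \<times> site) set) \<Rightarrow> nat set set" where
  "glue P = (\<Union>i<n. edge i ` (P i \<inter> set (own_edges (B i))))"

lemma edge_in_glue_iff:
  assumes "i < n" "k \<in> set (own_edges (B i))"
  shows "edge i k \<in> glue P \<longleftrightarrow> k \<in> P i"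
  using assms edge_eq_iff unfolding glue_def by blast

lemma perfect_matching_glue:
  assumes matching: "\<And>i. i < n \<Longrightarrow> local_matching (B i) (P i)"
    and link: "\<And>i. i < n \<Longrightarrow> (Prev 2, Here 0) \<in> P i \<longleftrightarrow> (Here 2, Next 0) \<in> P (pv i)"
      "\<And>i. i < n \<Longrightarrow> (Prev 3, Here 1) \<in> P i \<longleftrightarrow> (Here 3, Next 1) \<in> P (pv i)"
  shows "perfect_matching V E (glue P)"
proof -
  have "k \<in> trace i (glue P) \<longleftrightarrow> k \<in> P i" if "i < n" "k \<in> set (all_edges (B i))" for i k
    using that(2)
    by (cases rule: all_edges_cases) (use that(1) link in \<open>simp_all add: trace_def edge_in_glue_iff\<close>)
  then have "local_matching (B i) (trace i (glue P))" if "i < n" for i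
    using matching[OF that] local_matching_cong[of "B i" "trace i (glue P)" "P i"] that by blast
  moreover have "glue P \<subseteq> E"
    by (auto simp: glue_def E_def)
  ultimately show ?thesis
    by (simp add: perfect_matching_iff)
qed

end

section \<open>Cyclic connectivity of rings\<close>

definition inner_cut :: "dipole \<Rightarrow> (nat \<Rightarrow> bool) \<Rightarrow> nat" where
  "inner_cut D X = length (filter (\<lambda>(a, b). X a \<noteq> X b) (inner D))"

text \<open>Vertices 0 to 3 carry one link each, so this counts the edges leaving a set within a block.\<close>

definition boundary :: "dipole \<Rightarrow> (nat \<Rightarrow> bool) \<Rightarrow> nat" where
  "boundary D X = inner_cut D X + length (filter X [0, 1, 2, 3])"

definition population :: "dipole \<Rightarrow> (nat \<Rightarrow> bool) \<Rightarrow> nat" where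
  "population D X = length (filter X [0..<order D])"

definition wide_cut :: "dipole \<Rightarrow> (nat \<Rightarrow> bool) \<Rightarrow> bool" where
  "wide_cut D X \<longleftrightarrow> population D X \<noteq> 0 \<longrightarrow>
    (population D X < order D \<longrightarrow> 2 \<le> inner_cut D X) \<and>
    (if population D X = 1 then 3 else 4) \<le> boundary D X"

definition well_connected :: "dipole \<Rightarrow> bool" where
  "well_connected D \<longleftrightarrow> (\<forall>X. wide_cut D X)"

lemma population_eq_0_iff: "population D X = 0 \<longleftrightarrow> (\<forall>c<order D. \<not> X c)"
  by (auto simp: population_def filter_empty_conv)

lemma population_less_iff: "population D X < order D \<longleftrightarrow> (\<exists>c<order D. \<not> X c)"
proof
  assume "population D X < order D"
  then have "filter X [0..<order D] \<noteq> [0..<order D]"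
    by (auto simp: population_def)
  then show "\<exists>c<order D. \<not> X c"
    by (auto simp: filter_id_conv)
next
  assume "\<exists>c<order D. \<not> X c"
  then show "population D X < order D"
    using length_filter_less[of _ "[0..<order D]" X] by (auto simp: population_def)
qed

lemma population_eq_card: "population D X = card {c. c < order D \<and> X c}"
proof -
  have "population D X = card (set (filter X [0..<order D]))"
    unfolding population_def by (rule distinct_card[symmetric]) simp
  then show ?thesis
    by simp
qed

context dipole_ring
begin

definition part :: "nat set \<Rightarrow> nat \<Rightarrow> nat \<Rightarrow> bool" where
  "part S i c \<longleftrightarrow> vx i c \<in> S"

definition block_cut :: "nat set \<Rightarrow> nat \<Rightarrow> nat" where
  "block_cut S i = of_bool (part S i 2 \<noteq> part S (nx i) 0) + of_bool (part S i 3 \<noteq> part S (nx i) 1)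
    + inner_cut (B i) (part S i)"

lemma card_edge_cut: "card (edge_cut E S) = (\<Sum>i<n. block_cut S i)"
proof -
  have crosses: "edge i k \<inter> S \<noteq> {} \<and> \<not> edge i k \<subseteq> S \<longleftrightarrow>
      (place i (fst k) \<in> S) \<noteq> (place i (snd k) \<in> S)" for i k
    by (auto simp: edge_def)
  have "length (filter (\<lambda>k. (place i (fst k) \<in> S) \<noteq> (place i (snd k) \<in> S)) (inner_edges (B i)))
      = inner_cut (B i) (part S i)" for i
    unfolding inner_edges_def inner_cut_def filter_map length_map
    by (intro arg_cong[where f = length] filter_cong refl) (auto simp: part_def)
  then have "length (filter (\<lambda>k. edge i k \<inter> S \<noteq> {} \<and> \<not> edge i k \<subseteq> S) (own_edges (B i)))
      = block_cut S i" for i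
    unfolding crosses by (simp add: own_edges_def block_cut_def part_def)
  then show ?thesis
    by (simp add: edge_cut_def card_filter_E)
qed

lemma two_block_cuts_le:
  assumes "i < n" "j < n" "i \<noteq> j"
  shows "block_cut S i + block_cut S j \<le> card (edge_cut E S)"
proof -
  have "sum (block_cut S) {i, j} \<le> sum (block_cut S) {..<n}"
    using assms by (intro sum_mono2) auto
  then show ?thesis
    using assms by (simp add: card_edge_cut)
qed

lemma boundary_le_edge_cut:
  assumes "i < n" "T \<subseteq> block i"
  shows "boundary (B i) (part T i) \<le> card (edge_cut E T)"
proof -
  have "\<not> part T j c" if "j \<noteq> i" for j c
    using assms(2) that by (auto simp: part_def block_def)
  then have "boundary (B i) (part T i) \<le> block_cut T i + block_cut T (pv i)"
    using assms(1) by (simp add: boundary_def block_cut_def)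
  also have "\<dots> \<le> card (edge_cut E T)"
    using assms(1) by (intro two_block_cuts_le) simp_all
  finally show ?thesis .
qed

lemma edge_cut_within_block:
  assumes "well_connected (B i)" "i < n" "T \<subseteq> block i"
  shows "T \<noteq> {} \<Longrightarrow> 3 \<le> card (edge_cut E T)" and "2 \<le> card T \<Longrightarrow> 4 \<le> card (edge_cut E T)"
proof -
  have "T = vx i ` {c. c < order (B i) \<and> part T i c}"
    using assms(3) by (auto simp: part_def block_def)
  then have card_T: "card T = population (B i) (part T i)"
    unfolding population_eq_card by (metis card_image inj_on_vx)
  have bound: "population (B i) (part T i) \<noteq> 0 \<Longrightarrow>
      (if population (B i) (part T i) = 1 then 3 else 4) \<le> card (edge_cut E T)"
    using assms(1) boundary_le_edge_cut[OF assms(2,3)] unfolding well_connected_def wide_cut_def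
    by (meson le_trans)
  show "4 \<le> card (edge_cut E T)" if "2 \<le> card T"
    using bound that unfolding card_T by (simp split: if_splits)
  assume "T \<noteq> {}"
  moreover have "finite T"
    using assms(3) by (rule finite_subset) (simp add: block_def)
  ultimately have "population (B i) (part T i) \<noteq> 0"
    unfolding card_T[symmetric] by simp
  from bound[OF this] show "3 \<le> card (edge_cut E T)"
    by (simp split: if_splits)
qed

definition splits :: "nat set \<Rightarrow> nat \<Rightarrow> bool" where
  "splits S i \<longleftrightarrow> (\<exists>a<order (B i). part S i a) \<and> (\<exists>b<order (B i). \<not> part S i b)"

definition breaks :: "nat set \<Rightarrow> nat \<Rightarrow> bool" where
  "breaks S i \<longleftrightarrow> splits S i \<or> \<not> splits S (nx i) \<and> part S i 0 \<noteq> part S (nx i) 0"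

lemma part_eq_if_not_splits:
  assumes "\<not> splits S i" "c < order (B i)"
  shows "part S i c \<longleftrightarrow> part S i 0"
  using assms terminals_less_order(1)[of i] unfolding splits_def by blast

lemma two_le_block_cut_if_breaks:
  assumes "well_connected (B i)" "breaks S i"
  shows "2 \<le> block_cut S i"
proof (cases "splits S i")
  case True
  then have "2 \<le> inner_cut (B i) (part S i)"
    using assms(1) population_eq_0_iff[of "B i" "part S i"] population_less_iff[of "B i" "part S i"]
    unfolding splits_def well_connected_def wide_cut_def by blast
  then show ?thesis
    by (simp add: block_cut_def)
next
  case False
  then have "part S i 2 \<noteq> part S (nx i) 0" "part S i 3 \<noteq> part S (nx i) 1"
    using assms(2) part_eq_if_not_splits[of S i 2] part_eq_if_not_splits[of S i 3]
      part_eq_if_not_splits[of S "nx i" 1] by (simp_all add: breaks_def)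
  then show ?thesis
    by (simp add: block_cut_def)
qed

lemma small_cut_within_block:
  assumes wc: "\<And>i. well_connected (B i)" and "S \<subseteq> V" "card (edge_cut E S) \<le> 3"
  obtains m where "m < n" "S \<subseteq> block m \<or> V - S \<subseteq> block m"
proof -
  have unique: "i = j" if "i < n" "j < n" "breaks S i" "breaks S j" for i j
    using two_block_cuts_le[OF that(1,2), of S] assms(3)
      two_le_block_cut_if_breaks[OF wc that(3)] two_le_block_cut_if_breaks[OF wc that(4)] by linarith
  obtain m where m: "m < n" "\<And>i. i < n \<Longrightarrow> i \<noteq> m \<Longrightarrow> \<not> breaks S i"
  proof (cases "\<exists>i<n. breaks S i")
    case True
    then show thesis
      using unique that by blast
  next
    case False
    then show thesis
      using that[of 0] three_le_n by simp
  qed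
  have "i = m \<or> part S i 0 = part S (nx m) 0" if "i < n" for i
    using m(1) that
  proof (induction i rule: ring_induct)
    case (step j)
    then show ?case
      using m(2)[of j] m(2)[of "nx j"] by (auto simp: breaks_def)
  qed simp
  then have "vx i c \<in> S \<longleftrightarrow> part S (nx m) 0" if "i < n" "i \<noteq> m" "c < order (B i)" for i c
    using m(2)[OF that(1,2)] part_eq_if_not_splits[of S i c] that by (auto simp: breaks_def part_def)
  then have "v \<in> S \<longleftrightarrow> part S (nx m) 0" if "v \<in> V" "v \<notin> block m" for v
    using that by (auto elim!: V_cases)
  then have "S \<subseteq> block m \<or> V - S \<subseteq> block m"
    using assms(2) by blast
  then show thesis
    using m(1) that by blast
qed

lemma edge_cut_lower_bounds:
  assumes wc: "\<And>i. well_connected (B i)" and "S \<subseteq> V"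
  shows "S \<noteq> {} \<Longrightarrow> S \<noteq> V \<Longrightarrow> 3 \<le> card (edge_cut E S)"
    and "2 \<le> card S \<Longrightarrow> 2 \<le> card (V - S) \<Longrightarrow> 4 \<le> card (edge_cut E S)"
proof -
  have "(S \<noteq> {} \<longrightarrow> S \<noteq> V \<longrightarrow> 3 \<le> card (edge_cut E S)) \<and>
    (2 \<le> card S \<longrightarrow> 2 \<le> card (V - S) \<longrightarrow> 4 \<le> card (edge_cut E S))"
  proof (cases "card (edge_cut E S) \<le> 3")
    case True
    then obtain m where m: "m < n" "S \<subseteq> block m \<or> V - S \<subseteq> block m"
      using small_cut_within_block[OF assms] by blast
    from m(2) show ?thesis
    proof
      assume "S \<subseteq> block m"
      then show ?thesis
        using edge_cut_within_block[OF wc m(1)] by blast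
    next
      assume "V - S \<subseteq> block m"
      moreover have "V - S \<noteq> {}" if "S \<noteq> V"
        using that assms(2) by blast
      ultimately show ?thesis
        using edge_cut_within_block[OF wc m(1), of "V - S"] edge_cut_Compl[OF simple_graph] by metis
    qed
  qed simp
  then show "S \<noteq> {} \<Longrightarrow> S \<noteq> V \<Longrightarrow> 3 \<le> card (edge_cut E S)"
    "2 \<le> card S \<Longrightarrow> 2 \<le> card (V - S) \<Longrightarrow> 4 \<le> card (edge_cut E S)"
    by blast+
qed

lemma bridgeless:
  assumes "\<And>i. well_connected (B i)"
  shows "bridgeless V E"
  using simple_graph
proof (rule bridgelessI)
  fix S assume "S \<subseteq> V" "S \<noteq> {}" "S \<noteq> V"
  then show "2 \<le> card (edge_cut E S)"
    using edge_cut_lower_bounds(1)[OF assms, of S] by linarith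
qed

lemma cyclically_4_connected:
  assumes "\<And>i. well_connected (B i)"
  shows "cyclically_connected 4 V E"
  using simple_graph
proof (rule cyclically_connectedI)
  fix S assume "S \<subseteq> V" "3 \<le> card S" "3 \<le> card (V - S)"
  then show "4 \<le> card (edge_cut E S)"
    using edge_cut_lower_bounds(2)[OF assms, of S] by linarith
qed

end

section \<open>Girth of rings\<close>

definition inner_graph :: "dipole \<Rightarrow> nat set set" where
  "inner_graph D = (\<lambda>(a, b). {a, b}) ` set (inner D)"

definition short_cycle_free :: "dipole \<Rightarrow> bool" where
  "short_cycle_free D \<longleftrightarrow> triangle_free (inner_graph D) \<and> quadrilateral_free (inner_graph D) \<and>
    {2, 3} \<notin> inner_graph D"

lemma in_inner_graph_iff: "{a, b} \<in> inner_graph D \<longleftrightarrow> (a, b) \<in> set (inner D) \<or> (b, a) \<in> set (inner D)"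
  by (auto simp: inner_graph_def doubleton_eq_iff)

definition linked :: "nat \<Rightarrow> nat \<Rightarrow> bool" where
  "linked a b \<longleftrightarrow> a = 2 \<and> b = 0 \<or> a = 3 \<and> b = 1"

definition block_index :: "nat \<Rightarrow> nat" where
  "block_index v = fst (prod_decode v)"

definition position :: "nat \<Rightarrow> nat" where
  "position v = snd (prod_decode v)"

lemma block_index_vx [simp]: "block_index (vx i c) = i"
  by (simp add: block_index_def vx_def)

lemma vx_block_index_position [simp]: "vx (block_index v) (position v) = v"
  by (simp add: block_index_def position_def vx_def)

context dipole_ring
begin

lemma edge_iff:
  "{vx i a, vx j b} \<in> E \<longleftrightarrow> i < n \<and> j < n \<and>
    (i = j \<and> {a, b} \<in> inner_graph (B i) \<or> j = nx i \<and> linked a b \<or> i = nx j \<and> linked b a)" (is "?L \<longleftrightarrow> ?R")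
proof
  assume ?L
  then obtain k l where kl: "{vx i a, vx j b} = edge l k" "l < n" "k \<in> set (own_edges (B l))"
    by (auto simp: E_def)
  from kl(3) show ?R
    by (cases rule: own_edges_cases)
      (use kl(1,2) in \<open>auto simp: edge_def doubleton_eq_iff in_inner_graph_iff linked_def\<close>)
next
  have inner: "{vx i a, vx i b} \<in> E" if "i < n" "(a, b) \<in> set (inner (B i))" for i a b
    using own_edge_in_E[of i "(Here a, Here b)"] that
    by (simp add: edge_def own_edges_def inner_edges_def image_iff Bex_def)
  have link: "{vx i a, vx (nx i) b} \<in> E" if "i < n" "linked a b" for i a b
    using own_edge_in_E[of i "(Here 2, Next 0)"] own_edge_in_E[of i "(Here 3, Next 1)"] that
    by (auto simp: edge_def linked_def)
  assume ?R
  then show ?L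
    using inner[of i a b] inner[of i b a] link[of i a b] link[of j b a]
    by (auto simp: in_inner_graph_iff insert_commute)
qed

lemma edge_within_block:
  assumes "{u, v} \<in> E" "block_index u = block_index v"
  shows "{position u, position v} \<in> inner_graph (B (block_index u))"
proof -
  have "{vx (block_index u) (position u), vx (block_index v) (position v)} \<in> E"
    using assms(1) by simp
  then show ?thesis
    unfolding edge_iff using assms(2) by auto
qed

lemma edge_in_V: "{u, v} \<in> E \<Longrightarrow> u \<in> V" "{u, v} \<in> E \<Longrightarrow> v \<in> V"
  using simple_graph_edge_subset[OF simple_graph] by blast+

lemma edge_irrefl: "{v, v} \<notin> E"
  using simple_graph by (auto simp: simple_graph_def)

lemma link_to_next_not_in_short_cycle:
  assumes scf: "\<And>i. short_cycle_free (B i)" and "i < n" "linked a b"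
    and p: "{p, vx i a} \<in> E" "p \<noteq> vx (nx i) b" and q: "{vx (nx i) b, q} \<in> E" "q \<noteq> vx i a"
  shows "p \<noteq> q \<and> {p, q} \<notin> E"
proof -
  obtain k c l d where kl: "p = vx k c" "q = vx l d"
    using edge_in_V(1)[OF p(1)] edge_in_V(2)[OF q(1)] by (auto elim!: V_cases)
  have "k = i" "{c, a} \<in> inner_graph (B i)"
    using p assms(2,3) unfolding kl edge_iff by (auto simp: linked_def)
  moreover have "l = nx i" "{b, d} \<in> inner_graph (B (nx i))"
    using q assms(2,3) unfolding kl edge_iff by (auto simp: linked_def)
  moreover have "\<not> linked c d"
  proof
    assume "linked c d"
    moreover have "c \<noteq> a"
      using \<open>{c, a} \<in> inner_graph (B i)\<close> by (auto simp: in_inner_graph_iff dest: inner_less)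
    ultimately have "{c, a} = {2, 3}"
      using assms(3) by (auto simp: linked_def)
    then show False
      using \<open>{c, a} \<in> inner_graph (B i)\<close> scf[of i] by (simp add: short_cycle_free_def)
  qed
  ultimately show ?thesis
    using assms(2) unfolding kl edge_iff by auto
qed

lemma link_not_in_short_cycle:
  assumes scf: "\<And>i. short_cycle_free (B i)"
    and xy: "{x, y} \<in> E" "block_index x \<noteq> block_index y"
    and p: "{p, x} \<in> E" "p \<noteq> y" and q: "{y, q} \<in> E" "q \<noteq> x"
  shows "p \<noteq> q \<and> {p, q} \<notin> E"
proof -
  obtain i a j b where ij: "x = vx i a" "y = vx j b"
    using edge_in_V[OF xy(1)] by (auto elim!: V_cases)
  with xy consider "j = nx i" "linked a b" "i < n" | "i = nx j" "linked b a" "j < n"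
    by (auto simp: edge_iff)
  then show ?thesis
  proof cases
    case 1
    then show ?thesis
      using link_to_next_not_in_short_cycle[OF scf, of i a b p q] p q ij by simp
  next
    case 2
    then show ?thesis
      using link_to_next_not_in_short_cycle[OF scf, of j b a q p] p q ij by (simp add: insert_commute)
  qed
qed

lemma triangle_free:
  assumes scf: "\<And>i. short_cycle_free (B i)"
  shows "triangle_free E"
  unfolding triangle_free_def
proof (intro allI impI notI)
  fix x y z assume xyz: "{x, y} \<in> E" "{y, z} \<in> E" "{z, x} \<in> E"
  have same_block: "block_index u = block_index v" if "{u, v} \<in> E" "{v, w} \<in> E" "{w, u} \<in> E" for u v w
  proof -
    have "w \<noteq> v" "w \<noteq> u"
      using that(2,3) edge_irrefl by auto
    then show ?thesis
      using link_not_in_short_cycle[OF scf that(1) _ that(3) _ that(2)] by blast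
  qed
  have "block_index y = block_index x" "block_index z = block_index x"
    using same_block[OF xyz] same_block[OF xyz(2,3,1)] by auto
  then have "{position x, position y} \<in> inner_graph (B (block_index x))"
    "{position y, position z} \<in> inner_graph (B (block_index x))"
    "{position z, position x} \<in> inner_graph (B (block_index x))"
    using xyz[THEN edge_within_block] by simp_all
  then show False
    using scf[of "block_index x"] unfolding short_cycle_free_def triangle_free_def by blast
qed

lemma quadrilateral_free:
  assumes scf: "\<And>i. short_cycle_free (B i)"
  shows "quadrilateral_free E"
  unfolding quadrilateral_free_def
proof (intro allI impI notI)
  fix w x y z
  assume wxyz: "{w, x} \<in> E" "{x, y} \<in> E" "{y, z} \<in> E" "{z, w} \<in> E" and ne: "y \<noteq> w" "z \<noteq> x"
  have same_block: "block_index b = block_index c"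
    if "{a, b} \<in> E" "{b, c} \<in> E" "{c, d} \<in> E" "{d, a} \<in> E" "c \<noteq> a" "d \<noteq> b" for a b c d
    using link_not_in_short_cycle[OF scf that(2) _ that(1) _ that(3)] that(4-6)
    by (auto simp: insert_commute)
  have blocks: "block_index x = block_index w"
    "block_index y = block_index w" "block_index z = block_index w"
    using same_block[of z w x y] same_block[of w x y z] same_block[of x y z w] wxyz ne by auto
  then have "{position w, position x} \<in> inner_graph (B (block_index w))"
    "{position x, position y} \<in> inner_graph (B (block_index w))"
    "{position y, position z} \<in> inner_graph (B (block_index w))"
    "{position z, position w} \<in> inner_graph (B (block_index w))"
    using wxyz[THEN edge_within_block] by simp_all
  moreover have "position y \<noteq> position w" "position z \<noteq> position x"
    using blocks ne vx_block_index_position by metis+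
  ultimately show False
    using scf[of "block_index w"] unfolding short_cycle_free_def quadrilateral_free_def by blast
qed

lemma is_cycle_inner:
  assumes "i < n" "is_cycle {..<order (B i)} (inner_graph (B i)) xs"
  shows "is_cycle V E (map (vx i) xs)"
proof -
  have "{vx i (xs ! k), vx i (xs ! (Suc k mod length xs))} \<in> E" if "k < length xs" for k
    using is_cycle_edge[OF assms(2) that] assms(1) by (simp add: edge_iff)
  moreover have "Suc k mod length xs < length xs" if "k < length xs" for k
    using that by (intro mod_less_divisor) linarith
  ultimately show ?thesis
    using assms by (auto simp: is_cycle_def distinct_map inj_on_vx)
qed

lemma girth_eq_5:
  assumes "\<And>i. short_cycle_free (B i)"
    and "i < n" "is_cycle {..<order (B i)} (inner_graph (B i)) xs" "length xs = 5"
  shows "girth V E = 5"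
proof (rule antisym)
  show "girth V E \<le> 5"
    using girth_le_length[OF is_cycle_inner[OF assms(2,3)]] assms(4) by (simp add: numeral_eq_enat)
  show "5 \<le> girth V E"
    using assms(1) by (intro five_le_girthI triangle_free quadrilateral_free)
qed

end

section \<open>Edges of a ring left uncovered by three perfect matchings\<close>

type_synonym colour = "bool \<times> bool \<times> bool"

definition colour :: "'e set \<Rightarrow> 'e set \<Rightarrow> 'e set \<Rightarrow> 'e \<Rightarrow> colour" where
  "colour L M N e = (e \<in> L, e \<in> M, e \<in> N)"

definition uncovered :: "colour list \<Rightarrow> nat" where
  "uncovered cs = length (filter (\<lambda>c. c = (False, False, False)) cs)"

fun weight :: "colour \<Rightarrow> nat" where
  "weight (x, y, z) = of_bool x + of_bool y + of_bool z"

fun distance :: "colour \<Rightarrow> colour \<Rightarrow> nat" where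
  "distance (x, y, z) (x', y', z') = of_bool (x \<noteq> x') + of_bool (y \<noteq> y') + of_bool (z \<noteq> z')"

text \<open>
  Twice the amount an absorbing block can transfer across two parallel links with the given colours.
  It is largest for two distinct proper colours, the only state in which an obstructing block may have
  no uncovered edge.
\<close>

definition potential :: "colour \<Rightarrow> colour \<Rightarrow> nat" where
  "potential c d =
    (if distance c d = 1 then 1 else if weight c = 1 \<and> weight d = 1 \<and> c \<noteq> d then 3 else 0)"

text \<open>
  Colours are listed along \<open>all_edges\<close>: first those of the two links from the preceding block, then
  those of the two links to the following block.
\<close>

fun absorbs :: "colour list \<Rightarrow> bool" where
  "absorbs (a # a' # b # b' # cs) \<longleftrightarrow> potential a a' + potential b b' \<le> 2 * uncovered cs"
| "absorbs _ \<longleftrightarrow> False"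

fun obstructs :: "colour list \<Rightarrow> bool" where
  "obstructs (a # a' # b # b' # cs) \<longleftrightarrow>
    6 \<le> potential a a' + potential b b' + 2 * uncovered (a # a' # b # b' # cs)"
| "obstructs _ \<longleftrightarrow> False"

definition local_colouring :: "dipole \<Rightarrow> colour list \<Rightarrow> bool" where
  "local_colouring D cs \<longleftrightarrow> (\<exists>L M N. local_matching D L \<and> local_matching D M \<and> local_matching D N \<and>
    cs = map (colour L M N) (all_edges D))"

definition absorbing :: "dipole \<Rightarrow> bool" where
  "absorbing D \<longleftrightarrow> (\<forall>cs. local_colouring D cs \<longrightarrow> absorbs cs)"

definition obstructing :: "dipole \<Rightarrow> bool" where
  "obstructing D \<longleftrightarrow> (\<forall>cs. local_colouring D cs \<longrightarrow> obstructs cs)"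

lemma uncovered_simps:
  "uncovered [] = 0" "uncovered (c # cs) = of_bool (c = (False, False, False)) + uncovered cs"
  by (simp_all add: uncovered_def)

context dipole_ring
begin

definition block_colours :: "(nat set \<Rightarrow> colour) \<Rightarrow> nat \<Rightarrow> colour list" where
  "block_colours \<chi> i = map (\<lambda>k. \<chi> (edge i k)) (all_edges (B i))"

definition inner_uncovered :: "(nat set \<Rightarrow> colour) \<Rightarrow> nat \<Rightarrow> nat" where
  "inner_uncovered \<chi> i = uncovered (map (\<lambda>k. \<chi> (edge i k)) (inner_edges (B i)))"

definition link_uncovered :: "(nat set \<Rightarrow> colour) \<Rightarrow> nat \<Rightarrow> nat" where
  "link_uncovered \<chi> i = uncovered [\<chi> (edge i (Here 2, Next 0)), \<chi> (edge i (Here 3, Next 1))]"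

definition link_potential :: "(nat set \<Rightarrow> colour) \<Rightarrow> nat \<Rightarrow> nat" where
  "link_potential \<chi> i = potential (\<chi> (edge i (Here 2, Next 0))) (\<chi> (edge i (Here 3, Next 1)))"

lemma local_colouring_block_colours:
  assumes "perfect_matching V E L" "perfect_matching V E M" "perfect_matching V E N" "i < n"
  shows "local_colouring (B i) (block_colours (colour L M N) i)"
proof -
  have "local_matching (B i) (trace i M)" if "perfect_matching V E M" for M
    using that assms(4) perfect_matching_iff by (auto simp: perfect_matching_def)
  moreover have "colour (trace i L) (trace i M) (trace i N) = (\<lambda>k. colour L M N (edge i k))"
    by (simp add: fun_eq_iff colour_def trace_def)
  ultimately show ?thesis
    using assms(1-3) unfolding local_colouring_def block_colours_def by metis
qed

lemma block_colours_eq: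
  assumes "i < n"
  shows "block_colours \<chi> i =
    \<chi> (edge (pv i) (Here 2, Next 0)) # \<chi> (edge (pv i) (Here 3, Next 1)) #
    \<chi> (edge i (Here 2, Next 0)) # \<chi> (edge i (Here 3, Next 1)) #
    map (\<lambda>k. \<chi> (edge i k)) (inner_edges (B i))"
  using assms by (simp add: block_colours_def all_edges_def own_edges_def)

lemma link_potential_if_absorbs:
  assumes "i < n" "absorbs (block_colours \<chi> i)"
  shows "link_potential \<chi> (pv i) + link_potential \<chi> i \<le> 2 * inner_uncovered \<chi> i"
  using assms(2) unfolding block_colours_eq[OF assms(1)]
  by (simp add: link_potential_def inner_uncovered_def)

lemma link_potential_if_obstructs:
  assumes "i < n" "obstructs (block_colours \<chi> i)"
  shows "6 \<le> link_potential \<chi> (pv i) + link_potential \<chi> i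
    + 2 * (link_uncovered \<chi> (pv i) + link_uncovered \<chi> i + inner_uncovered \<chi> i)"
  using assms(2)
  unfolding block_colours_eq[OF assms(1)] obstructs.simps
    link_potential_def link_uncovered_def inner_uncovered_def uncovered_simps
  by (simp only: ac_simps add_0)

lemma card_uncovered:
  "card {e \<in> E. \<chi> e = (False, False, False)} = (\<Sum>i<n. inner_uncovered \<chi> i + link_uncovered \<chi> i)"
  unfolding card_filter_E
  by (intro sum.cong refl)
    (simp add: own_edges_def inner_uncovered_def link_uncovered_def uncovered_def filter_map o_def)

lemma ring_discharging:
  fixes need free gain :: "nat \<Rightarrow> int" and charge :: "nat \<Rightarrow> nat \<Rightarrow> int"
  assumes "\<And>i. i < n \<Longrightarrow> need i \<le> free i + charge i (pv i) + charge i i"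
    and "\<And>i. i < n \<Longrightarrow> charge i i + charge (nx i) i \<le> gain i"
  shows "(\<Sum>i<n. need i) \<le> (\<Sum>i<n. free i + gain i)"
proof -
  have shift: "(\<Sum>i<n. charge i (pv i)) = (\<Sum>i<n. charge (nx i) i)"
    using sum_pv[of "\<lambda>i. charge (nx i) i"] by (simp cong: sum.cong_simp)
  have "(\<Sum>i<n. need i) \<le> (\<Sum>i<n. free i + charge i (pv i) + charge i i)"
    using assms(1) by (intro sum_mono) simp
  also have "\<dots> = (\<Sum>i<n. free i + (charge i i + charge (nx i) i))"
    by (simp add: sum.distrib shift)
  also have "\<dots> \<le> (\<Sum>i<n. free i + gain i)"
    using assms(2) by (intro sum_mono) simp
  finally show ?thesis .
qed

lemma uncovered_lower_bound:
  assumes "A \<subseteq> {..<n}"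
    and obstructing: "\<And>i. i \<in> A \<Longrightarrow> obstructing (B i)"
    and absorbing: "\<And>i. i < n \<Longrightarrow> i \<notin> A \<Longrightarrow> absorbing (B i)"
    and isolated: "\<And>i. i \<in> A \<Longrightarrow> nx i \<notin> A"
    and pm: "perfect_matching V E L" "perfect_matching V E M" "perfect_matching V E N"
  shows "3 * card A \<le> card (E - (L \<union> M \<union> N))"
proof -
  let ?\<chi> = "colour L M N"
  define charge where "charge i j =
    (if i \<in> A then int (2 * link_uncovered ?\<chi> j + link_potential ?\<chi> j)
     else - int (link_potential ?\<chi> j))" for i j
  have "(\<Sum>i<n. 6 * of_bool (i \<in> A))
      \<le> (\<Sum>i<n. 2 * int (inner_uncovered ?\<chi> i) + 2 * int (link_uncovered ?\<chi> i))"
  proof (rule ring_discharging)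
    fix i assume i: "i < n"
    note colouring = local_colouring_block_colours[OF pm i]
    show "6 * of_bool (i \<in> A) \<le> 2 * int (inner_uncovered ?\<chi> i) + charge i (pv i) + charge i i"
    proof (cases "i \<in> A")
      case True
      then have "obstructs (block_colours ?\<chi> i)"
        using obstructing colouring unfolding obstructing_def by blast
      from link_potential_if_obstructs[OF i this] show ?thesis
        using True by (simp add: charge_def)
    next
      case False
      then have "absorbs (block_colours ?\<chi> i)"
        using absorbing[OF i] colouring unfolding absorbing_def by blast
      from link_potential_if_absorbs[OF i this] show ?thesis
        using False by (simp add: charge_def)
    qed
    show "charge i i + charge (nx i) i \<le> 2 * int (link_uncovered ?\<chi> i)"
      using isolated[of i] by (auto simp: charge_def)
  qed
  also have "\<dots> = 2 * int (card {e \<in> E. ?\<chi> e = (False, False, False)})"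
    by (simp add: card_uncovered sum.distrib sum_distrib_left)
  also have "{e \<in> E. ?\<chi> e = (False, False, False)} = E - (L \<union> M \<union> N)"
    by (auto simp: colour_def)
  also have "(\<Sum>i<n. 6 * of_bool (i \<in> A)) = 6 * int (card A)"
    using assms(1) by (simp add: sum_distrib_left[symmetric] of_bool_def sum.If_cases Int_absorb1)
  finally show ?thesis
    by simp
qed

lemma card_V: "card V = (\<Sum>i<n. order (B i))"
proof -
  have "card V = (\<Sum>i<n. card (block i))"
    unfolding V_def by (rule card_UN_disjoint) (auto simp: block_def)
  also have "\<dots> = (\<Sum>i<n. order (B i))"
    by (simp add: block_def card_image inj_on_vx)
  finally show ?thesis .
qed

lemma card_E: "card E = (\<Sum>i<n. length (own_edges (B i)))"
  using card_filter_E[of "\<lambda>_. True"] by simp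

end

section \<open>Enumerating the local behaviour of a dipole\<close>

definition traces :: "dipole \<Rightarrow> bool list list" where
  "traces D = map (\<lambda>xs. map (\<lambda>k. k \<in> set xs) (all_edges D))
    (exact_transversals (map (star D) [0..<order D]))"

lemma trace_in_traces:
  assumes "cubic_dipole D" "local_matching D M"
  shows "map (\<lambda>k. k \<in> M) (all_edges D) \<in> set (traces D)"
proof -
  obtain xs where xs: "xs \<in> set (exact_transversals (map (star D) [0..<order D]))"
      "set xs = M \<inter> \<Union> (set ` set (map (star D) [0..<order D]))"
    using exact_transversals_complete[of "map (star D) [0..<order D]" M] assms(2)
    by (auto simp: local_matching_def)
  have "\<exists>c\<in>{0..<order D}. k \<in> set (star D c)" if "k \<in> set (all_edges D)" for k
  proof -
    have "(\<exists>c\<in>{0..<order D}. fst k = Here c) \<or> (\<exists>c\<in>{0..<order D}. snd k = Here c)"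
      using that assms(1) by (auto elim!: all_edges_cases own_edges_cases simp: cubic_dipole_def)
    then show ?thesis
      using that unfolding in_star_iff by blast
  qed
  then have "map (\<lambda>k. k \<in> set xs) (all_edges D) = map (\<lambda>k. k \<in> M) (all_edges D)"
    unfolding xs(2) by auto
  then show ?thesis
    using xs(1) unfolding traces_def set_map by (intro image_eqI[of _ _ xs]) simp_all
qed

lemma local_colouring_cases:
  assumes "cubic_dipole D" "local_colouring D cs"
  obtains xs ys zs where "xs \<in> set (traces D)" "ys \<in> set (traces D)" "zs \<in> set (traces D)"
    "cs = zip xs (zip ys zs)"
proof -
  obtain L M N where lm: "local_matching D L" "local_matching D M" "local_matching D N"
    and cs: "cs = map (colour L M N) (all_edges D)"
    using assms(2) unfolding local_colouring_def by blast
  have "cs = zip (map (\<lambda>k. k \<in> L) (all_edges D))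
      (zip (map (\<lambda>k. k \<in> M) (all_edges D)) (map (\<lambda>k. k \<in> N) (all_edges D)))"
    unfolding cs by (simp add: zip_map_map colour_def[abs_def] zip_same_conv_map)
  then show thesis
    using that lm[THEN trace_in_traces[OF assms(1)]] by blast
qed

fun all_bool_lists :: "nat \<Rightarrow> (bool list \<Rightarrow> bool) \<Rightarrow> bool" where
  "all_bool_lists 0 P \<longleftrightarrow> P []"
| "all_bool_lists (Suc n) P \<longleftrightarrow>
    all_bool_lists n (\<lambda>bs. P (True # bs)) \<and> all_bool_lists n (\<lambda>bs. P (False # bs))"

lemma all_bool_listsD: "all_bool_lists n P \<Longrightarrow> length bs = n \<Longrightarrow> P bs"
proof (induction n arbitrary: P bs)
  case (Suc n)
  then obtain b bs' where "bs = b # bs'" "length bs' = n"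
    by (auto simp: length_Suc_conv)
  then show ?case
    using Suc by (cases b) auto
qed simp

lemma wide_cut_cong:
  assumes "cubic_dipole D" "\<And>c. c < order D \<Longrightarrow> X c \<longleftrightarrow> Y c"
  shows "wide_cut D X \<longleftrightarrow> wide_cut D Y"
proof -
  have "population D X = population D Y"
    unfolding population_def using assms(2) by (intro arg_cong[where f = length] filter_cong) simp_all
  moreover have "inner_cut D X = inner_cut D Y"
    unfolding inner_cut_def using assms
    by (intro arg_cong[where f = length] filter_cong) (auto simp: cubic_dipole_def)
  moreover have "filter X [0, 1, 2, 3] = filter Y [0, 1, 2, 3]"
    using assms by (intro filter_cong) (auto simp: cubic_dipole_def)
  ultimately show ?thesis
    by (simp only: wide_cut_def boundary_def)
qed

lemma well_connectedI:
  assumes "cubic_dipole D" "all_bool_lists (order D) (\<lambda>bs. wide_cut D ((!) bs))"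
  shows "well_connected D"
  unfolding well_connected_def
proof
  fix X :: "nat \<Rightarrow> bool"
  have "wide_cut D ((!) (map X [0..<order D]))"
    by (rule all_bool_listsD[OF assms(2)]) simp
  then show "wide_cut D X"
    using wide_cut_cong[OF assms(1), of "(!) (map X [0..<order D])" X] by simp
qed

definition arcs :: "dipole \<Rightarrow> (nat \<times> nat) list" where
  "arcs D = inner D @ map prod.swap (inner D)"

definition neighbours :: "dipole \<Rightarrow> nat \<Rightarrow> nat list" where
  "neighbours D a = map snd (filter (\<lambda>k. fst k = a) (arcs D))"

lemma in_inner_graph_iff_arc: "{a, b} \<in> inner_graph D \<longleftrightarrow> (a, b) \<in> set (arcs D)"
  by (auto simp: in_inner_graph_iff arcs_def)

lemma in_neighbours_iff: "b \<in> set (neighbours D a) \<longleftrightarrow> (a, b) \<in> set (arcs D)"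
  by (auto simp: neighbours_def image_iff)

lemma triangle_free_inner_graph_iff:
  "triangle_free (inner_graph D) \<longleftrightarrow>
    (\<forall>(x, y)\<in>set (arcs D). \<forall>z\<in>set (neighbours D y). (z, x) \<notin> set (arcs D))"
  unfolding triangle_free_def in_inner_graph_iff_arc
    Ball_def in_neighbours_iff split_paired_All prod.case
  by blast

lemma quadrilateral_free_inner_graph_iff:
  "quadrilateral_free (inner_graph D) \<longleftrightarrow>
    (\<forall>(w, x)\<in>set (arcs D). \<forall>y\<in>set (neighbours D x). \<forall>z\<in>set (neighbours D y).
      y \<noteq> w \<longrightarrow> z \<noteq> x \<longrightarrow> (z, w) \<notin> set (arcs D))"
  unfolding quadrilateral_free_def in_inner_graph_iff_arc
    Ball_def in_neighbours_iff split_paired_All prod.case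
  by blast

section \<open>The two blocks\<close>

definition I_block :: dipole where
  "I_block = Dipole 8 [(0,4), (0,7), (1,5), (1,6), (2,4), (2,5), (3,6), (3,7), (4,6), (5,7)]"

definition H_block :: dipole where
  "H_block = Dipole 10
    [(0,5), (0,6), (1,4), (1,7), (2,4), (2,5), (3,6), (3,7), (4,8), (5,9), (6,8), (7,9), (8,9)]"

lemma cubic_dipole_I: "cubic_dipole I_block" and cubic_dipole_H: "cubic_dipole H_block"
  by code_simp+

lemma well_connected_I: "well_connected I_block"
  by (rule well_connectedI[OF cubic_dipole_I]) code_simp

lemma well_connected_H: "well_connected H_block"
  by (rule well_connectedI[OF cubic_dipole_H]) code_simp

lemma short_cycle_free_I: "short_cycle_free I_block" and short_cycle_free_H: "short_cycle_free H_block"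
  unfolding short_cycle_free_def in_inner_graph_iff
    triangle_free_inner_graph_iff quadrilateral_free_inner_graph_iff
  by code_simp+

lemma is_cycle_I: "is_cycle {..<order I_block} (inner_graph I_block) [0, 4, 6, 3, 7]"
  unfolding is_cycle_def in_inner_graph_iff by code_simp

lemma absorbing_I: "absorbing I_block"
proof -
  have "\<forall>xs\<in>set (traces I_block). \<forall>ys\<in>set (traces I_block). \<forall>zs\<in>set (traces I_block).
      absorbs (zip xs (zip ys zs))"
    by code_simp
  then show ?thesis
    unfolding absorbing_def by (blast elim: local_colouring_cases[OF cubic_dipole_I])
qed

lemma obstructing_H: "obstructing H_block"
proof -
  have "\<forall>xs\<in>set (traces H_block). \<forall>ys\<in>set (traces H_block). \<forall>zs\<in>set (traces H_block).
      obstructs (zip xs (zip ys zs))"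
    by code_simp
  then show ?thesis
    unfolding obstructing_def by (blast elim: local_colouring_cases[OF cubic_dipole_H])
qed

text \<open>
  Three matchings leaving exactly three edges of every H-block uncovered. Both links behind an I-block
  belong to matching 0 only, those behind an H-block to matching 1 only; \<open>g\<close> and \<open>h\<close> tell whether the
  preceding and the present block are H-blocks.
\<close>

definition inner_patterns :: "bool \<Rightarrow> bool \<Rightarrow> (nat \<times> nat) list list" where
  "inner_patterns g h =
    (if h then [[(2,4), (3,7), (5,9), (6,8)], [(0,5), (1,4), (6,8), (7,9)],
      [(0,5), (1,7), (2,4), (3,6), (8,9)]]
     else if g then [[(0,4), (1,6), (5,7)], [(2,5), (3,7), (4,6)], [(0,7), (1,5), (2,4), (3,6)]]
     else [[(4,6), (5,7)], [(0,4), (1,6), (2,5), (3,7)], [(0,7), (1,5), (2,4), (3,6)]])"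

definition pattern :: "bool \<Rightarrow> bool \<Rightarrow> nat \<Rightarrow> (site \<times> site) list" where
  "pattern g h m =
    (if m = of_bool g then [(Prev 2, Here 0), (Prev 3, Here 1)] else []) @
    (if m = of_bool h then [(Here 2, Next 0), (Here 3, Next 1)] else []) @
    map (map_prod Here Here) (inner_patterns g h ! m)"

definition petersen_block :: "bool \<Rightarrow> dipole" where
  "petersen_block h = (if h then H_block else I_block)"

lemma link_in_pattern_iff:
  "(Prev 2, Here 0) \<in> set (pattern g h m) \<longleftrightarrow> m = of_bool g"
  "(Prev 3, Here 1) \<in> set (pattern g h m) \<longleftrightarrow> m = of_bool g"
  "(Here 2, Next 0) \<in> set (pattern g h m) \<longleftrightarrow> m = of_bool h"
  "(Here 3, Next 1) \<in> set (pattern g h m) \<longleftrightarrow> m = of_bool h"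
  by (auto simp: pattern_def)

lemma local_matching_pattern:
  assumes "\<not> (g \<and> h)" "m < 3"
  shows "local_matching (petersen_block h) (set (pattern g h m))"
proof -
  have "\<forall>(g, h)\<in>{(False, False), (False, True), (True, False)}. \<forall>m\<in>{0, 1, 2}.
      local_matching (petersen_block h) (set (pattern g h m))"
    by code_simp
  moreover have "(g, h) \<in> {(False, False), (False, True), (True, False)}" "m \<in> {0, 1, 2}"
    using assms by auto
  ultimately show ?thesis
    by blast
qed

lemma uncovered_pattern:
  "\<forall>g h. length (filter (\<lambda>k. \<forall>m\<in>{0, 1, 2}. k \<notin> set (pattern g h m)) (own_edges (petersen_block h)))
    = 3 * of_bool h"
  by code_simp

section \<open>Rings of I- and H-blocks\<close>

locale petersen_ring =
  fixes n :: nat and A :: "nat set"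
  assumes n_ge_3: "3 \<le> n"
    and A_subset: "A \<subseteq> {..<n}"
    and A_isolated: "\<And>i. i \<in> A \<Longrightarrow> Suc i mod n \<notin> A"
begin

sublocale dipole_ring n "\<lambda>i. petersen_block (i \<in> A)"
  using n_ge_3 cubic_dipole_I cubic_dipole_H by unfold_locales (simp_all add: petersen_block_def)

lemma nx_notin_A: "i \<in> A \<Longrightarrow> nx i \<notin> A"
  using A_isolated by (simp add: nx_def)

lemma sum_of_bool_A: "(\<Sum>i<n. of_bool (i \<in> A)) = card A"
  using A_subset by (simp add: of_bool_def sum.If_cases Int_absorb1)

lemma card_vertices: "card V = 8 * n + 2 * card A"
proof -
  have "order (petersen_block h) = 8 + 2 * of_bool h" for h
    by (simp add: petersen_block_def I_block_def H_block_def)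
  then show ?thesis
    by (simp add: card_V sum.distrib sum_distrib_left[symmetric] sum_of_bool_A)
qed

lemma card_edges: "card E = 12 * n + 3 * card A"
proof -
  have "length (own_edges (petersen_block h)) = 12 + 3 * of_bool h" for h
    by (simp add: petersen_block_def I_block_def H_block_def own_edges_def inner_edges_def)
  then show ?thesis
    by (simp add: card_E sum.distrib sum_distrib_left[symmetric] sum_of_bool_A)
qed

definition optimal_matching :: "nat \<Rightarrow> nat set set" where
  "optimal_matching m = glue (\<lambda>i. set (pattern (pv i \<in> A) (i \<in> A) m))"

lemma perfect_matching_optimal:
  assumes "m < 3"
  shows "perfect_matching V E (optimal_matching m)"
  unfolding optimal_matching_def
proof (rule perfect_matching_glue)
  fix i assume "i < n"
  then have "\<not> (pv i \<in> A \<and> i \<in> A)"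
    using nx_notin_A[of "pv i"] by auto
  then show "local_matching (petersen_block (i \<in> A)) (set (pattern (pv i \<in> A) (i \<in> A) m))"
    using assms by (rule local_matching_pattern)
qed (simp_all only: link_in_pattern_iff)

lemma card_uncovered_optimal:
  "card (E - (optimal_matching 0 \<union> optimal_matching 1 \<union> optimal_matching 2)) = 3 * card A"
proof -
  have "card (E - (optimal_matching 0 \<union> optimal_matching 1 \<union> optimal_matching 2))
      = card {e \<in> E. \<forall>m\<in>{0, 1, 2}. e \<notin> optimal_matching m}"
    by (rule arg_cong[where f = card]) auto
  also have "\<dots> = (\<Sum>i<n. 3 * of_bool (i \<in> A))"
    unfolding card_filter_E
  proof (intro sum.cong refl)
    fix i assume "i \<in> {..<n}"
    let ?own = "own_edges (petersen_block (i \<in> A))"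
    have "filter (\<lambda>k. \<forall>m\<in>{0, 1, 2}. edge i k \<notin> optimal_matching m) ?own
        = filter (\<lambda>k. \<forall>m\<in>{0, 1, 2}. k \<notin> set (pattern (pv i \<in> A) (i \<in> A) m)) ?own"
      using \<open>i \<in> {..<n}\<close>
      by (intro filter_cong refl) (simp add: optimal_matching_def edge_in_glue_iff)
    then show "length (filter (\<lambda>k. \<forall>m\<in>{0, 1, 2}. edge i k \<notin> optimal_matching m) ?own)
        = 3 * of_bool (i \<in> A)"
      by (simp only: uncovered_pattern[rule_format])
  qed
  also have "\<dots> = 3 * card A"
    by (simp add: sum_distrib_left[symmetric] sum_of_bool_A)
  finally show ?thesis .
qed

lemma m3_eq: "m3 V E = 4 * real n / (4 * real n + real (card A))"
proof -
  have "m3 V E = 1 - real (3 * card A) / real (card E)"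
  proof (rule m3_eqI)
    show "finite E"
      by (rule simple_graph_finite_edges[OF simple_graph])
    show "E \<noteq> {}"
      using card_edges n_ge_3 by auto
    show "3 * card A \<le> card (E - (L \<union> M \<union> N))"
      if "perfect_matching V E L" "perfect_matching V E M" "perfect_matching V E N" for L M N
      using A_subset _ _ nx_notin_A that
      by (rule uncovered_lower_bound) (simp_all add: petersen_block_def absorbing_I obstructing_H)
    show "perfect_matching V E (optimal_matching 0)" "perfect_matching V E (optimal_matching 1)"
      "perfect_matching V E (optimal_matching 2)"
      by (simp_all add: perfect_matching_optimal)
    show "card (E - (optimal_matching 0 \<union> optimal_matching 1 \<union> optimal_matching 2)) = 3 * card A"
      by (rule card_uncovered_optimal)
  qed
  then show ?thesis
    using n_ge_3 by (simp add: card_edges field_simps)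
qed

lemma well_connected: "well_connected (petersen_block h)"
  by (simp add: petersen_block_def well_connected_I well_connected_H)

lemma girth:
  assumes "0 \<notin> A"
  shows "girth V E = 5"
proof (rule girth_eq_5)
  show "short_cycle_free (petersen_block (i \<in> A))" for i
    by (simp add: petersen_block_def short_cycle_free_I short_cycle_free_H)
  show "0 < n"
    using n_ge_3 by simp
  show "is_cycle {..<order (petersen_block (0 \<in> A))} (inner_graph (petersen_block (0 \<in> A)))
      [0, 4, 6, 3, 7]"
    using assms is_cycle_I by (simp add: petersen_block_def)
qed simp

end

lemma card_odd_less: "card {i. i < 2 * a \<and> odd i} = a"
proof -
  have "{i. i < 2 * a \<and> odd i} = (\<lambda>i. 2 * i + 1) ` {..<a}"
    by (auto simp: image_iff elim!: oddE)
  moreover have "inj_on (\<lambda>i::nat. 2 * i + 1) {..<a}"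
    by (auto simp: inj_on_def)
  ultimately show ?thesis
    by (simp add: card_image)
qed

lemma petersen_ring_graph_exists:
  assumes "3 \<le> n" "2 * h \<le> n"
  shows "\<exists>V E. (cubic_graph V E \<and> bridgeless V E \<and> cyclically_connected 4 V E \<and> girth V E = 5 \<and>
    m3 V E = 4 * real n / (4 * real n + real h)) \<and> card V = 8 * n + 2 * h"
proof -
  let ?A = "{i. i < 2 * h \<and> odd i}"
  interpret petersen_ring n ?A
  proof
    show "Suc i mod n \<notin> ?A" if "i \<in> ?A" for i
      using that assms(2) by (auto simp: mod_Suc)
  qed (use assms in auto)
  have "girth V E = 5"
    by (rule girth) simp
  then show ?thesis
    using cubic_graph bridgeless[OF well_connected] cyclically_4_connected[OF well_connected]
      m3_eq card_vertices unfolding card_odd_less by blast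
qed

lemma petersen_ring_graph_with_ratio:
  assumes "p < q" "8 * (q - p) \<le> p"
  shows "\<exists>V E. (cubic_graph V E \<and> bridgeless V E \<and> cyclically_connected 4 V E \<and> girth V E = 5 \<and>
    m3 V E = real p / real q) \<and> card V = 8 * q * Suc k"
proof -
  define r where "r = q - p"
  have q: "q = p + r"
    using assms(1) by (simp add: r_def)
  have "8 \<le> p"
    using assms by linarith
  then have "3 \<le> p * Suc k"
    by simp
  moreover have "2 * (4 * r * Suc k) \<le> p * Suc k"
    using mult_le_mono1[OF assms(2), of "Suc k"] by (simp add: r_def)
  moreover have "4 * real (p * Suc k) / (4 * real (p * Suc k) + real (4 * r * Suc k)) = real p / real q"
  proof -
    have numerator: "4 * real (p * Suc k) = 4 * real (Suc k) * real p"
      by (simp only: of_nat_mult ac_simps)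
    have denominator: "4 * real (Suc k) * real p + real (4 * r * Suc k) = 4 * real (Suc k) * real q"
      by (simp add: q algebra_simps)
    show ?thesis
      unfolding numerator denominator by (rule mult_divide_mult_cancel_left) simp
  qed
  moreover have "8 * (p * Suc k) + 2 * (4 * r * Suc k) = 8 * q * Suc k"
    by (simp add: q algebra_simps)
  ultimately show ?thesis
    using petersen_ring_graph_exists[of "p * Suc k" "4 * r * Suc k"] by simp
qed

section \<open>Infinitely many graphs\<close>

lemma graph_iso_card: "graph_iso G H \<Longrightarrow> card (fst G) = card (fst H)"
  by (auto simp: graph_iso_def intro: bij_betw_same_card)

theorem theorem2:
  fixes p q :: nat
  assumes "q > 0" and "9 / 10 \<le> real p / real q" and "real p / real q < 1"
  shows "\<exists>S :: (nat set \<times> nat set set) set. infinite S \<and>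
    (\<forall>(V, E) \<in> S. cubic_graph V E \<and> bridgeless V E \<and> cyclically_connected 4 V E \<and>
        girth V E = 5 \<and> m3 V E = real p / real q) \<and>
    (\<forall>G \<in> S. \<forall>H \<in> S. G \<noteq> H \<longrightarrow> \<not> graph_iso G H)"
proof -
  have "p < q" "9 * real q \<le> 10 * real p"
    using assms by (simp_all add: field_simps)
  then have "8 * (q - p) \<le> p"
    by linarith
  then obtain V E where VE: "\<And>k. cubic_graph (V k) (E k) \<and> bridgeless (V k) (E k) \<and>
      cyclically_connected 4 (V k) (E k) \<and> girth (V k) (E k) = 5 \<and> m3 (V k) (E k) = real p / real q"
    and order: "\<And>k. card (V k) = 8 * q * Suc k"
    using petersen_ring_graph_with_ratio[OF \<open>p < q\<close>] by metis
  have iso: "k = l" if "graph_iso (V k, E k) (V l, E l)" for k l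
    using graph_iso_card[OF that] order assms(1) by simp
  have "inj (\<lambda>k. (V k, E k))"
  proof (rule injI)
    fix k l assume "(V k, E k) = (V l, E l)"
    then have "card (V k) = card (V l)"
      by simp
    then show "k = l"
      using assms(1) unfolding order by simp
  qed
  then have "infinite (range (\<lambda>k. (V k, E k)))"
    by (rule range_inj_infinite)
  then show ?thesis
    using VE iso by (intro exI[of _ "range (\<lambda>k. (V k, E k))"]) auto
qed

end
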